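(* Let $T\in\mathcal{CPMM}$, let $\mathcal P$ be a Markov partition for $T$, and let $M$ be the transition matrix of $T$ with respect to $\mathcal P$. (i) If $T$ is leo then any $\lambda$-solution for $M$ is summable. (ii) Any $\lambda$-solution $v=(v_j)_{j\in\mathcal P}$ for $M$ satisfies $$\forall\,\varepsilon\in(0,1/2):\quad \sum_{j\in\mathcal P,\ j\subset(\varepsilon,1-\varepsilon)}v_j<\infty.$$
   Context: A continuous map on a closed interval is piecewise monotone if the interval splits into finitely many subintervals on each of which the map is monotone. A Markov partition for a continuous map $T:[0,1]\to[0,1]$ is a finite or countably infinite collection $\mathcal P$ of closed nondegenerate subintervals of $[0,1]$ such that: (1) distinct elements of $\mathcal P$ have disjoint interiors and $[0,1]\setminus\bigcup\mathcal P$ is at most countable; (2) $T|_i$ is monotone for each $i\in\mathcal P$ (classical), or piecewise monotone for each $i\in\mathcal P$ (slack); (3) for all $i,j\in\mathcal P$ and every maximal interval $i'\subset i$ of monotonicity of $T$, if $T(i')\cap j^\circ\ne\emptyset$ then $T(i')\supset j$. $\mathcal{CPMM}$ is the set of continuous maps $T:[0,1]\to[0,1]$ that are topologically mixing (for all nonempty open $U,V$ there is $n$ with $T^m(U)\cap V\neq\emptyset$ for all $m\ge n$), admit a countably infinite Markov partition, and have finite topological entropy. $T\in\mathcal{CPMM}$ is leo (locally eventually onto) if for every nonempty open set $U$ there is $n\in\mathbb N$ with $T^n(U)=[0,1]$. Transition matrix of $T$ with respect to $\mathcal P$: $M=(m_{ij})_{i,j\in\mathcal P}$, where $m_{ij}=0$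 if $T(i)\not\supset j$, and otherwise $m_{ij}$ is the maximal number of intervals $i_1,\dots,i_\kappa\subset i$ with pairwise disjoint interiors such that each $T|_{i_\ell}$ is monotone and $T(i_\ell)\supset j$ (this number is finite). For $\lambda>0$, a $\lambda$-solution for $M$ is a nonzero nonnegative sequence $v=(v_i)_{i\in\mathcal P}$ with $\sum_{j\in\mathcal P}m_{ij}v_j=\lambda v_i$ for all $i\in\mathcal P$; it is summable if $v\in\ell^1(\mathcal P)$. *)

theory Defs
  imports "HOL-Analysis.Analysis"
begin

text \<open>
  A map \<open>[0,1] \<rightarrow> [0,1]\<close> is a function \<open>T :: real \<Rightarrow> real\<close> sending \<open>{0..1}\<close> into itself.
  No definition below depends on the values of \<open>T\<close> outside \<open>{0..1}\<close>.
\<close>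

definition continuous_interval_map :: "(real \<Rightarrow> real) \<Rightarrow> bool" where
  "continuous_interval_map T \<longleftrightarrow> continuous_on {0..1} T \<and> T ` {0..1} \<subseteq> {0..1}"

text \<open>Monotonicity is weak, as usual for interval maps.\<close>

definition monotone_map_on :: "real set \<Rightarrow> (real \<Rightarrow> real) \<Rightarrow> bool" where
  "monotone_map_on S T \<longleftrightarrow> mono_on S T \<or> antimono_on S T"

definition piecewise_monotone_on :: "real set \<Rightarrow> (real \<Rightarrow> real) \<Rightarrow> bool" where
  "piecewise_monotone_on S T \<longleftrightarrow> (\<exists>D. D division_of S \<and> (\<forall>d\<in>D. monotone_map_on d T))"

definition maximal_monotonicity_interval :: "(real \<Rightarrow> real) \<Rightarrow> real set \<Rightarrow> real set \<Rightarrow> bool" where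
  "maximal_monotonicity_interval T i i' \<longleftrightarrow>
     is_interval i' \<and> i' \<subseteq> i \<and> monotone_map_on i' T \<and>
     (\<forall>k. is_interval k \<and> i' \<subseteq> k \<and> k \<subseteq> i \<and> monotone_map_on k T \<longrightarrow> k = i')"

text \<open>
  The collection may be finite or countably infinite. The disjunction covers classical
  partitions (first alternative) and slack partitions (second alternative).
\<close>

definition markov_partition :: "(real \<Rightarrow> real) \<Rightarrow> real set set \<Rightarrow> bool" where
  "markov_partition T P \<longleftrightarrow>
     countable P \<and>
     (\<forall>i\<in>P. \<exists>a b. 0 \<le> a \<and> a < b \<and> b \<le> 1 \<and> i = {a..b}) \<and>
     (\<forall>i\<in>P. \<forall>j\<in>P. i \<noteq> j \<longrightarrow> interior i \<inter> interior j = {}) \<and>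
     countable ({0..1} - \<Union>P) \<and>
     ((\<forall>i\<in>P. monotone_map_on i T) \<or> (\<forall>i\<in>P. piecewise_monotone_on i T)) \<and>
     (\<forall>i\<in>P. \<forall>j\<in>P. \<forall>i'. maximal_monotonicity_interval T i i' \<longrightarrow>
        T ` i' \<inter> interior j \<noteq> {} \<longrightarrow> j \<subseteq> T ` i')"

text \<open>Open sets are taken in the subspace topology of \<open>{0..1}\<close>.\<close>

definition topologically_mixing :: "(real \<Rightarrow> real) \<Rightarrow> bool" where
  "topologically_mixing T \<longleftrightarrow>
     (\<forall>U V. openin (top_of_set {0..1}) U \<and> openin (top_of_set {0..1}) V \<and> U \<noteq> {} \<and> V \<noteq> {} \<longrightarrow>
        (\<exists>n. \<forall>m\<ge>n. (T ^^ m) ` U \<inter> V \<noteq> {}))"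

definition leo :: "(real \<Rightarrow> real) \<Rightarrow> bool" where
  "leo T \<longleftrightarrow>
     (\<forall>U. openin (top_of_set {0..1}) U \<and> U \<noteq> {} \<longrightarrow> (\<exists>n. (T ^^ n) ` U = {0..1}))"

text \<open>
  Topological entropy by \<open>(n, \<epsilon>)\<close>-separated sets, for a continuous self-map of a nonempty
  compact set \<open>K\<close>. In that case the maximum exists, and the supremum over \<open>\<epsilon>\<close> is the limit
  for \<open>\<epsilon> \<rightarrow> 0\<close>, because the separation numbers increase as \<open>\<epsilon>\<close> decreases.
\<close>

definition separated_set ::
    "'a::metric_space set \<Rightarrow> ('a \<Rightarrow> 'a) \<Rightarrow> nat \<Rightarrow> real \<Rightarrow> 'a set \<Rightarrow> bool" where
  "separated_set K T n \<epsilon> E \<longleftrightarrow>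
     finite E \<and> E \<subseteq> K \<and>
     (\<forall>x\<in>E. \<forall>y\<in>E. x \<noteq> y \<longrightarrow> (\<exists>k<n. dist ((T ^^ k) x) ((T ^^ k) y) > \<epsilon>))"

definition separation_number ::
    "'a::metric_space set \<Rightarrow> ('a \<Rightarrow> 'a) \<Rightarrow> nat \<Rightarrow> real \<Rightarrow> nat" where
  "separation_number K T n \<epsilon> = Max {card E | E. separated_set K T n \<epsilon> E}"

definition topological_entropy :: "'a::metric_space set \<Rightarrow> ('a \<Rightarrow> 'a) \<Rightarrow> ereal" where
  "topological_entropy K T =
     (SUP \<epsilon>\<in>{0<..}. limsup (\<lambda>n. ereal (ln (real (separation_number K T n \<epsilon>)) / real n)))"

definition CPMM :: "(real \<Rightarrow> real) set" where
  "CPMM = {T. continuous_interval_map T \<and> topologically_mixing T \<and>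
     (\<exists>P. markov_partition T P \<and> infinite P) \<and> topological_entropy {0..1} T < \<infinity>}"

text \<open>
  Since \<open>j\<close> is nondegenerate, intervals whose images contain \<open>j\<close> are nondegenerate; those with
  pairwise disjoint interiors are therefore distinct, so that a set \<open>K\<close> of intervals
  represents the family. The maximum exists when \<open>T\<close> is continuous and piecewise monotone
  on \<open>i\<close>.
\<close>

definition transition_matrix :: "(real \<Rightarrow> real) \<Rightarrow> real set \<Rightarrow> real set \<Rightarrow> nat" where
  "transition_matrix T i j =
     (if j \<subseteq> T ` i then
        Max {card K | K. finite K \<and>
          (\<forall>k\<in>K. is_interval k \<and> k \<subseteq> i \<and> monotone_map_on k T \<and> j \<subseteq> T ` k) \<and>
          pairwise (\<lambda>k l. interior k \<inter> interior l = {}) K}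
      else 0)"

text \<open>Vectors indexed by \<open>P\<close> are functions on sets, of which only the values on \<open>P\<close> matter.\<close>

definition lambda_solution ::
    "real set set \<Rightarrow> (real set \<Rightarrow> real set \<Rightarrow> nat) \<Rightarrow> real \<Rightarrow> (real set \<Rightarrow> real) \<Rightarrow> bool" where
  "lambda_solution P M l v \<longleftrightarrow>
     (\<forall>i\<in>P. v i \<ge> 0) \<and> (\<exists>i\<in>P. v i \<noteq> 0) \<and>
     (\<forall>i\<in>P. ((\<lambda>j. real (M i j) * v j) has_sum l * v i) P)"

end

theory Submission
  imports Defs
begin

text \<open>
  If \<open>(T ^^ n) ` i\<close> covers \<open>j\<close>, then some chain of \<open>n\<close> transitions leads from \<open>i\<close> to \<open>j\<close>, so
  iterating the eigenvalue equation \<open>n\<close> times at \<open>i\<close> bounds the sum of \<open>v\<close> over all such \<open>j\<close>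
  by \<open>l ^ n * v i\<close>. A leo map covers everything by an iterate of a single \<open>i\<close>; for a mixing map,
  some iterate of the interior of \<open>i\<close> is connected and meets both ends of the unit interval,
  hence covers \<open>{\<epsilon>..1 - \<epsilon>}\<close>.

  The chains are traced along uncountable intersections with the interior of \<open>j\<close>, because the
  points outside the interiors of the partition intervals are only countably many.
\<close>

section \<open>Maximal intervals of monotonicity\<close>

text \<open>A failure of monotonicity is witnessed by two pairs of points, and a single member of
  the chain contains all four.\<close>

lemma monotone_map_on_Union_chain:
  assumes chain: "\<And>k k'. k \<in> C \<Longrightarrow> k' \<in> C \<Longrightarrow> k \<subseteq> k' \<or> k' \<subseteq> k"
    and mono: "\<And>k. k \<in> C \<Longrightarrow> monotone_map_on k T"
  shows "monotone_map_on (\<Union>C) T"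
proof (rule ccontr)
  assume "\<not> monotone_map_on (\<Union>C) T"
  then obtain x y u w where xy: "x \<in> \<Union>C" "y \<in> \<Union>C" "x \<le> y" "\<not> T x \<le> T y"
    and uw: "u \<in> \<Union>C" "w \<in> \<Union>C" "u \<le> w" "\<not> T w \<le> T u"
    unfolding monotone_map_on_def monotone_on_def by blast
  have pair: "\<exists>k\<in>C. a \<in> k \<and> b \<in> k" if "a \<in> \<Union>C" "b \<in> \<Union>C" for a b
    using that chain by blast
  obtain k1 where k1: "k1 \<in> C" "x \<in> k1" "y \<in> k1" using pair xy by blast
  obtain k2 where k2: "k2 \<in> C" "u \<in> k2" "w \<in> k2" using pair uw by blast
  obtain k where k: "k \<in> C" "x \<in> k" "y \<in> k" "u \<in> k" "w \<in> k"
    using chain[OF k1(1) k2(1)] k1 k2 by blast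
  show False
    using mono[OF k(1)] k xy(3,4) uw(3,4) unfolding monotone_map_on_def monotone_on_def by blast
qed

text \<open>The Markov condition speaks only of maximal intervals, so a given interval of
  monotonicity has to be enlarged to one. Zorn's lemma does this, with unions as upper bounds of
  chains.\<close>

lemma ex_maximal_monotonicity_interval:
  assumes "is_interval d" "d \<subseteq> i" "monotone_map_on d T"
  obtains i' where "maximal_monotonicity_interval T i i'" "d \<subseteq> i'"
proof -
  define A where "A = {k. is_interval k \<and> d \<subseteq> k \<and> k \<subseteq> i \<and> monotone_map_on k T}"
  have "\<exists>M\<in>A. \<forall>X\<in>A. M \<subseteq> X \<longrightarrow> X = M"
  proof (rule subset_Zorn_nonempty)
    show "A \<noteq> {}" using assms by (auto simp: A_def)
  next
    fix C assume ne: "C \<noteq> {}" and ch: "subset.chain A C"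
    have CA: "C \<subseteq> A" and chain: "\<And>k k'. k \<in> C \<Longrightarrow> k' \<in> C \<Longrightarrow> k \<subseteq> k' \<or> k' \<subseteq> k"
      using ch unfolding subset.chain_def by auto
    have "is_interval (\<Union>C)"
      unfolding is_interval_1
    proof (intro ballI allI impI)
      fix a b x assume ab: "a \<in> \<Union>C" "b \<in> \<Union>C" and x: "a \<le> x \<and> x \<le> b"
      obtain k where "k \<in> C" "a \<in> k" "b \<in> k" using ab chain by blast
      then show "x \<in> \<Union>C" using x CA unfolding A_def is_interval_1 by blast
    qed
    moreover have "monotone_map_on (\<Union>C) T"
      using chain
    proof (rule monotone_map_on_Union_chain)
      show "monotone_map_on k T" if "k \<in> C" for k using that CA unfolding A_def by blast
    qed
    moreover have "d \<subseteq> \<Union>C" "\<Union>C \<subseteq> i" using ne CA unfolding A_def by blast+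
    ultimately show "\<Union>C \<in> A" unfolding A_def by simp
  qed
  then obtain M where "M \<in> A" and max: "\<And>X. X \<in> A \<Longrightarrow> M \<subseteq> X \<Longrightarrow> X = M" by blast
  then have M: "is_interval M" "d \<subseteq> M" "M \<subseteq> i" "monotone_map_on M T" by (auto simp: A_def)
  have "k = M" if "is_interval k" "M \<subseteq> k" "k \<subseteq> i" "monotone_map_on k T" for k
    using max[of k] that M(2) by (auto simp: A_def)
  then have "maximal_monotonicity_interval T i M"
    using M unfolding maximal_monotonicity_interval_def by blast
  then show thesis using M(2) by (rule that)
qed

lemma markov_partition_interval:
  assumes "markov_partition T P" "i \<in> P"
  obtains a b where "0 \<le> a" "a < b" "b \<le> 1" "i = {a..b}"
proof -
  have "\<exists>a b. 0 \<le> a \<and> a < b \<and> b \<le> 1 \<and> i = {a..b}"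
    using assms by (simp add: markov_partition_def)
  with that show thesis by auto
qed

text \<open>A point of \<open>i\<close> that maps into the interior of \<open>j\<close> lies in some
  piece of monotonicity. The image of a maximal interval around that piece still hits the interior
  of \<open>j\<close>, so by the Markov condition it covers \<open>j\<close>.\<close>

lemma markov_partition_covering_monotone_interval:
  assumes P: "markov_partition T P" and i: "i \<in> P" and j: "j \<in> P"
    and hit: "T ` i \<inter> interior j \<noteq> {}"
  obtains k where "is_interval k" "k \<subseteq> i" "monotone_map_on k T" "j \<subseteq> T ` k"
proof -
  obtain a b where ab: "i = {a..b}" "a < b" using markov_partition_interval[OF P i] by metis
  \<comment> \<open>The classical case becomes an instance of the slack one through the trivial
    division \<open>{i}\<close>.\<close>
  have "piecewise_monotone_on i T"
  proof (cases "monotone_map_on i T")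
    case True
    moreover have "{i} division_of i" using ab division_of_self[of a b] by simp
    ultimately show ?thesis unfolding piecewise_monotone_on_def by blast
  next
    case False
    then show ?thesis using P i unfolding markov_partition_def by blast
  qed
  then obtain D where D: "D division_of i" "\<forall>d\<in>D. monotone_map_on d T"
    unfolding piecewise_monotone_on_def by blast
  obtain x where x: "x \<in> i" "T x \<in> interior j" using hit by blast
  obtain d where d: "d \<in> D" "x \<in> d" using x division_ofD(6)[OF D(1)] by blast
  have "is_interval d" using division_ofD(4)[OF D(1) d(1)] is_interval_cbox by metis
  then obtain i' where i': "maximal_monotonicity_interval T i i'" "d \<subseteq> i'"
    using ex_maximal_monotonicity_interval division_ofD(2)[OF D(1) d(1)] D(2) d(1) by metis
  then have "T ` i' \<inter> interior j \<noteq> {}" using d x by blast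
  then have "j \<subseteq> T ` i'" using P i j i'(1) by (simp add: markov_partition_def)
  with i'(1) that[of i'] show thesis by (simp add: maximal_monotonicity_interval_def)
qed

section \<open>Positive entries of the transition matrix\<close>

text \<open>The interiors are disjoint subsets of the unit interval, each of Lebesgue measure at
  least \<open>\<eta>\<close>.\<close>

lemma card_intervals_le_inverse_length:
  fixes K :: "real set set"
  assumes "finite K" and "\<And>k. k \<in> K \<Longrightarrow> is_interval k" "\<And>k. k \<in> K \<Longrightarrow> k \<subseteq> {0..1}"
    and disj: "pairwise (\<lambda>k l. interior k \<inter> interior l = {}) K"
    and "\<eta> > 0" and wide: "\<And>k. k \<in> K \<Longrightarrow> \<exists>x\<in>k. \<exists>y\<in>k. \<eta> \<le> dist x y"
  shows "real (card K) \<le> 1 / \<eta>"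
proof -
  have len: "\<eta> \<le> measure lborel (interior k)" if k: "k \<in> K" for k
  proof -
    obtain x y where "x \<in> k" "y \<in> k" "\<eta> \<le> dist x y" using wide[OF k] by blast
    then obtain a b where ab: "a \<in> k" "b \<in> k" "\<eta> \<le> b - a"
      by (cases "x \<le> y") (auto simp: dist_real_def)
    have "{a<..<b} \<subseteq> k" using ab assms(2)[OF k] unfolding is_interval_1 by fastforce
    then have sub: "{a<..<b} \<subseteq> interior k" by (simp add: interior_maximal)
    have "interior k \<subseteq> {0..1}" using assms(3)[OF k] interior_subset by blast
    then have "emeasure lborel (interior k) \<le> emeasure lborel {0..1::real}"
      by (intro emeasure_mono) auto
    then have "emeasure lborel (interior k) < \<infinity>"
      by (rule le_less_trans) simp
    then have "measure lborel {a<..<b} \<le> measure lborel (interior k)"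
      using sub by (intro measure_mono_fmeasurable) (auto simp: fmeasurable_def)
    then show ?thesis using ab \<open>\<eta> > 0\<close> by simp
  qed
  have fm: "interior k \<in> fmeasurable lborel" if "k \<in> K" for k
  proof (rule fmeasurableI2[of "{0..1}"])
    show "interior k \<subseteq> {0..1}" using assms(3)[OF that] interior_subset by blast
  qed (auto simp: fmeasurable_compact)
  have "real (card K) * \<eta> \<le> (\<Sum>k\<in>K. measure lborel (interior k))"
    using sum_mono[of K "\<lambda>_. \<eta>", OF len] by simp
  also have "\<dots> = measure lborel (\<Union>k\<in>K. interior k)"
  proof (rule measure_UNION_AE[symmetric])
    show "pairwise (\<lambda>k l. AE x in lborel. x \<notin> interior k \<or> x \<notin> interior l) K"
      using disj by (rule pairwise_mono) (auto intro!: AE_I2)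
  qed (use fm \<open>finite K\<close> in auto)
  also have "\<dots> \<le> measure lborel {0..1::real}"
  proof (intro measure_mono_fmeasurable)
    show "(\<Union>k\<in>K. interior k) \<subseteq> {0..1}" using assms(3) interior_subset by blast
    have "open (\<Union>k\<in>K. interior k)" by blast
    then show "(\<Union>k\<in>K. interior k) \<in> sets lborel" by simp
  qed (simp add: fmeasurable_compact)
  finally show ?thesis using \<open>\<eta> > 0\<close> by (simp add: field_simps)
qed

text \<open>A member of a set bounds its \<open>Max\<close> from below only if the set is finite, so
  the sizes of the admissible families must first be bounded. After that, a single covering interval
  of monotonicity gives a family of size 1.\<close>

lemma transition_matrix_ge_1:
  assumes T: "continuous_on {0..1} T" and P: "markov_partition T P"
    and i: "i \<in> P" and j: "j \<in> P" and cover: "j \<subseteq> T ` i"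
  shows "transition_matrix T i j \<ge> 1"
proof -
  let ?F = "\<lambda>K. finite K \<and>
          (\<forall>k\<in>K. is_interval k \<and> k \<subseteq> i \<and> monotone_map_on k T \<and> j \<subseteq> T ` k) \<and>
          pairwise (\<lambda>k l. interior k \<inter> interior l = {}) K"
  obtain a b where ab: "a < b" "j = {a..b}" using markov_partition_interval[OF P j] by metis
  have i01: "i \<subseteq> {0..1}" using markov_partition_interval[OF P i] by (metis atLeastatMost_subset_iff)
  have "uniformly_continuous_on {0..1} T"
    using T by (simp add: compact_uniformly_continuous)
  \<comment> \<open>Points closer than \<open>\<eta>\<close> have images closer than the length of
    \<open>j\<close>. An interval whose image contains both endpoints of \<open>j\<close> therefore
    contains two points at distance at least \<open>\<eta>\<close>.\<close>
  then obtain \<eta> where \<eta>: "\<eta> > 0"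
      "\<And>x y. x \<in> {0..1} \<Longrightarrow> y \<in> {0..1} \<Longrightarrow> dist y x < \<eta> \<Longrightarrow> dist (T y) (T x) < b - a"
    using ab(1) unfolding uniformly_continuous_on_def by (metis diff_gt_0_iff_gt)
  have "real (card K) \<le> 1 / \<eta>" if K: "?F K" for K
  proof (rule card_intervals_le_inverse_length)
    fix k assume k: "k \<in> K"
    then have "{a..b} \<subseteq> T ` k" "k \<subseteq> i" using K ab by auto
    moreover have "a \<in> {a..b}" "b \<in> {a..b}" using ab by auto
    ultimately obtain x y where xy: "x \<in> k" "y \<in> k" "T x = a" "T y = b" by (metis imageE subsetD)
    then have "x \<in> {0..1}" "y \<in> {0..1}" "\<not> dist (T y) (T x) < b - a"
      using \<open>k \<subseteq> i\<close> i01 by (auto simp: dist_real_def)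
    then have "\<not> dist y x < \<eta>" using \<eta>(2) by blast
    then show "\<exists>x\<in>k. \<exists>y\<in>k. \<eta> \<le> dist x y" using xy by (meson not_less)
  next
    fix k assume "k \<in> K"
    then show "k \<subseteq> {0..1}" using K i01 by blast
  qed (use K \<eta>(1) in auto)
  then have "card K \<le> nat \<lfloor>1 / \<eta>\<rfloor>" if "?F K" for K
    using that le_nat_floor by blast
  then have "{card K |K. ?F K} \<subseteq> {..nat \<lfloor>1 / \<eta>\<rfloor>}" by blast
  then have fin: "finite {card K |K. ?F K}" using finite_subset by blast
  have "interior j \<noteq> {}" using ab by simp
  then have "T ` i \<inter> interior j \<noteq> {}" using cover interior_subset by blast
  then obtain k where "is_interval k" "k \<subseteq> i" "monotone_map_on k T" "j \<subseteq> T ` k"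
    using markov_partition_covering_monotone_interval[OF P i j] by metis
  then have "?F {k}" by simp
  then have "card {k} \<in> {card K |K. ?F K}" by blast
  then have "card {k} \<le> Max {card K |K. ?F K}" using fin by (rule Max_ge[rotated])
  then show ?thesis using cover by (simp add: transition_matrix_def)
qed

section \<open>Tracing chains of transitions\<close>

lemma countable_outside_interiors:
  assumes P: "markov_partition T P"
  shows "countable ({0..1} - (\<Union>k\<in>P. interior k))"
proof -
  have "countable (k - interior k)" if k: "k \<in> P" for k
  proof -
    obtain a b where "k = {a..b}" using markov_partition_interval[OF P k] by metis
    then have "k - interior k \<subseteq> {a, b}" by auto
    then show ?thesis using countable_subset countable_insert countable_empty by metis
  qed
  moreover have "countable P" "countable ({0..1} - \<Union>P)"
    using P unfolding markov_partition_def by simp_all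
  ultimately have "countable (({0..1} - \<Union>P) \<union> (\<Union>k\<in>P. k - interior k))"
    by simp
  then show ?thesis by (rule countable_subset[rotated]) blast
qed

text \<open>Splits off the first transition of a chain. Up to a countable set, the image of
  \<open>i\<close> is covered by the partition intervals contained in it, because by the Markov
  condition every interval whose interior it hits is one of them. These are countably many, so an
  uncountable overlap with \<open>A\<close> survives for at least one.\<close>

lemma uncountable_iterate_step:
  assumes T: "T ` {0..1} \<subseteq> {0..1}" and P: "markov_partition T P" and i: "i \<in> P"
    and unc: "uncountable (A \<inter> (T ^^ Suc n) ` i)"
  obtains k where "k \<in> P" "k \<subseteq> T ` i" "uncountable (A \<inter> (T ^^ n) ` k)"
proof -
  define S where "S = {k \<in> P. k \<subseteq> T ` i}"
  define E where "E = {0..1} - (\<Union>k\<in>P. interior k)"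
  have "i \<subseteq> {0..1}" using markov_partition_interval[OF P i] by (metis atLeastatMost_subset_iff)
  then have Ti: "T ` i \<subseteq> {0..1}" using T by blast
  have cover: "T ` i \<subseteq> \<Union>S \<union> E"
  proof
    fix y assume y: "y \<in> T ` i"
    show "y \<in> \<Union>S \<union> E"
    proof (cases "y \<in> E")
      case False
      then obtain k where k: "k \<in> P" "y \<in> interior k" using y Ti unfolding E_def by blast
      then have "T ` i \<inter> interior k \<noteq> {}" using y by blast
      then obtain d where "d \<subseteq> i" "k \<subseteq> T ` d"
        using markov_partition_covering_monotone_interval[OF P i k(1)] by metis
      then have "k \<in> S" using k(1) unfolding S_def by blast
      then show ?thesis using k(2) interior_subset by blast
    qed simp
  qed
  \<comment> \<open>The innermost application of \<open>T\<close> is separated, since the chain is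
    cut at its start.\<close>
  have "(T ^^ Suc n) ` i = (T ^^ n) ` T ` i"
    by (simp only: funpow_Suc_right image_comp)
  also have "\<dots> \<subseteq> (T ^^ n) ` (\<Union>S \<union> E)"
    using cover by (rule image_mono)
  also have "\<dots> = (\<Union>k\<in>S. (T ^^ n) ` k) \<union> (T ^^ n) ` E"
    by (simp only: image_Un image_Union)
  finally have "A \<inter> (T ^^ Suc n) ` i \<subseteq> A \<inter> ((\<Union>k\<in>S. (T ^^ n) ` k) \<union> (T ^^ n) ` E)"
    by (rule Int_mono[OF order_refl])
  also have "\<dots> \<subseteq> (\<Union>k\<in>S. A \<inter> (T ^^ n) ` k) \<union> (T ^^ n) ` E"
    unfolding Int_Un_distrib Int_UN_distrib by (intro Un_mono order_refl Int_lower2)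
  finally have sub: "A \<inter> (T ^^ Suc n) ` i \<subseteq> (\<Union>k\<in>S. A \<inter> (T ^^ n) ` k) \<union> (T ^^ n) ` E" .
  have "countable S" using P by (simp add: markov_partition_def S_def)
  moreover have "countable ((T ^^ n) ` E)"
    unfolding E_def by (intro countable_image countable_outside_interiors[OF P])
  moreover have "uncountable ((\<Union>k\<in>S. A \<inter> (T ^^ n) ` k) \<union> (T ^^ n) ` E)"
    using unc countable_subset[OF sub] by (rule contrapos_nn)
  ultimately obtain k where "k \<in> S" "uncountable (A \<inter> (T ^^ n) ` k)"
    using countable_UN[of S "\<lambda>k. A \<inter> (T ^^ n) ` k"] by (auto simp del: countable_UN)
  then show thesis using that[of k] by (simp add: S_def)
qed

section \<open>Iterating the eigenvalue equation\<close>

lemma lambda_solution_nonneg: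
  assumes "lambda_solution P M l v" "i \<in> P"
  shows "0 \<le> v i"
  using assms by (simp add: lambda_solution_def)

text \<open>Induction on \<open>n\<close>, grouping the targets in \<open>F\<close> by the first
  interval \<open>k\<close> of a chain from \<open>i\<close>. The induction hypothesis bounds each
  group by \<open>l ^ n * v k\<close>, and the equation at \<open>i\<close> bounds the sum over
  these \<open>k\<close>. The condition on targets is an uncountable overlap because that is what
  passes from \<open>i\<close> to a single \<open>k\<close>.\<close>

lemma lambda_solution_sum_le:
  assumes T: "continuous_interval_map T" and P: "markov_partition T P"
    and v: "lambda_solution P (transition_matrix T) l v" and l: "l > 0"
  shows "i \<in> P \<Longrightarrow> finite F \<Longrightarrow> F \<subseteq> {j \<in> P. uncountable (interior j \<inter> (T ^^ n) ` i)} \<Longrightarrow>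
    sum v F \<le> l ^ n * v i"
proof (induction n arbitrary: i F)
  case 0
  have vi: "0 \<le> v i" using lambda_solution_nonneg[OF v 0(1)] .
  obtain a b where ab: "i = {a..b}" using markov_partition_interval[OF P 0(1)] by metis
  \<comment> \<open>The interior of a different partition interval meets \<open>i\<close> at most in
    its two endpoints.\<close>
  have "j = i" if j: "j \<in> F" for j
  proof (rule ccontr)
    assume "j \<noteq> i"
    have "j \<in> P" and unc: "uncountable (interior j \<inter> i)" using 0(3) j by auto
    then have "interior j \<inter> interior i = {}"
      using P 0(1) \<open>j \<noteq> i\<close> unfolding markov_partition_def by blast
    moreover have "i - interior i \<subseteq> {a, b}" using ab by auto
    ultimately have "interior j \<inter> i \<subseteq> {a, b}" by blast
    then have "countable (interior j \<inter> i)"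
      using countable_subset countable_insert countable_empty by metis
    then show False using unc by blast
  qed
  then have "F \<subseteq> {i}" by blast
  then show ?case using vi by (auto simp: subset_singleton_iff)
next
  case (Suc n)
  note v_nonneg = lambda_solution_nonneg[OF v]
  let ?S = "{k \<in> P. k \<subseteq> T ` i}"
  have "\<exists>k\<in>?S. uncountable (interior j \<inter> (T ^^ n) ` k)" if "j \<in> F" for j
  proof -
    have unc: "uncountable (interior j \<inter> (T ^^ Suc n) ` i)" using that Suc.prems(3) by blast
    have "T ` {0..1} \<subseteq> {0..1}" using T by (simp add: continuous_interval_map_def)
    from uncountable_iterate_step[OF this P Suc.prems(1) unc]
    obtain k where "k \<in> P" "k \<subseteq> T ` i" "uncountable (interior j \<inter> (T ^^ n) ` k)" .
    then show ?thesis by blast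
  qed
  \<comment> \<open>\<open>f j\<close> is the chosen first interval on a chain from \<open>i\<close>
    to \<open>j\<close>.\<close>
  then obtain f where f: "\<And>j. j \<in> F \<Longrightarrow> f j \<in> ?S"
      "\<And>j. j \<in> F \<Longrightarrow> uncountable (interior j \<inter> (T ^^ n) ` f j)"
    by metis
  have fP: "f ` F \<subseteq> P" using f(1) by blast
  have "sum v F = (\<Sum>k\<in>f ` F. sum v {j \<in> F. f j = k})"
    using Suc.prems(2) by (rule sum.image_gen)
  also have "\<dots> \<le> (\<Sum>k\<in>f ` F. l ^ n * v k)"
  proof (intro sum_mono Suc.IH)
    fix k assume "k \<in> f ` F"
    show "{j \<in> F. f j = k} \<subseteq> {j \<in> P. uncountable (interior j \<inter> (T ^^ n) ` k)}"
      using Suc.prems(3) f(2) by blast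
  qed (use Suc.prems(2) fP in auto)
  also have "\<dots> \<le> (\<Sum>k\<in>f ` F. l ^ n * (real (transition_matrix T i k) * v k))"
  proof (intro sum_mono mult_left_mono)
    fix k assume "k \<in> f ` F"
    then have k: "k \<in> P" "k \<subseteq> T ` i" using f(1) by auto
    have "1 \<le> transition_matrix T i k"
      using transition_matrix_ge_1[OF _ P Suc.prems(1) k] T
      by (simp add: continuous_interval_map_def)
    then show "v k \<le> real (transition_matrix T i k) * v k"
      using mult_right_mono[of 1 "real (transition_matrix T i k)" "v k"] v_nonneg[OF k(1)] by simp
  qed (use l in simp)
  also have "\<dots> = l ^ n * (\<Sum>k\<in>f ` F. real (transition_matrix T i k) * v k)"
    by (simp add: sum_distrib_left)
  \<comment> \<open>The finite sum is part of the nonnegative series in the row of \<open>i\<close>,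
    whose total is \<open>l * v i\<close>.\<close>
  also have "\<dots> \<le> l ^ n * (l * v i)"
  proof (intro mult_left_mono)
    have row: "((\<lambda>k. real (transition_matrix T i k) * v k) has_sum l * v i) P"
      using v Suc.prems(1) by (simp add: lambda_solution_def)
    have "((\<lambda>k. real (transition_matrix T i k) * v k) has_sum
        (\<Sum>k\<in>f ` F. real (transition_matrix T i k) * v k)) (f ` F)"
      using Suc.prems(2) by (intro has_sum_finite) simp
    then show "(\<Sum>k\<in>f ` F. real (transition_matrix T i k) * v k) \<le> l * v i"
      using row by (rule has_sum_mono_neutral) (use fP v_nonneg in auto)
  qed (use l in simp)
  finally show ?case by (simp add: mult_ac)
qed

text \<open>The bound \<open>l ^ n * v i\<close> is the same for every finite set of targets. A
  covered \<open>j\<close> qualifies as a target since the overlap is then its whole interior, a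
  nonempty open interval.\<close>

lemma lambda_solution_summable_on_iterate:
  assumes T: "continuous_interval_map T" and P: "markov_partition T P"
    and v: "lambda_solution P (transition_matrix T) l v" and l: "l > 0" and i: "i \<in> P"
  shows "v summable_on {j \<in> P. j \<subseteq> (T ^^ n) ` i}"
proof (rule nonneg_bdd_above_summable_on)
  let ?A = "{j \<in> P. j \<subseteq> (T ^^ n) ` i}"
  show "0 \<le> v j" if "j \<in> ?A" for j using lambda_solution_nonneg[OF v] that by simp
  have unc: "uncountable (interior j \<inter> (T ^^ n) ` i)" if "j \<in> ?A" for j
  proof -
    have j: "j \<in> P" "j \<subseteq> (T ^^ n) ` i" using that by auto
    obtain a b where ab: "a < b" "j = {a..b}" using markov_partition_interval[OF P j(1)] by metis
    have "interior j \<inter> (T ^^ n) ` i = interior j" using j(2) interior_subset by blast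
    then show ?thesis using ab by (simp add: uncountable_open_interval)
  qed
  have "sum v F \<le> l ^ n * v i" if "F \<subseteq> ?A" "finite F" for F
    by (rule lambda_solution_sum_le[OF T P v l i that(2)]) (use that(1) unc in auto)
  then show "bdd_above (sum v ` {F. F \<subseteq> ?A \<and> finite F})"
    by (intro bdd_aboveI[of _ "l ^ n * v i"]) auto
qed

section \<open>Covering by iterates and conclusion\<close>

lemma continuous_interval_map_funpow:
  assumes "continuous_interval_map T"
  shows "continuous_interval_map (T ^^ n)"
proof (induction n)
  case 0
  show ?case by (simp add: continuous_interval_map_def id_def)
next
  case (Suc n)
  show ?case
    using Suc assms continuous_on_compose2[of "{0..1}" T "{0..1}" "T ^^ n"]
    by (auto simp: continuous_interval_map_def comp_def image_subset_iff)
qed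

lemma topologically_mixing_covers_core:
  assumes T: "continuous_interval_map T" and mix: "topologically_mixing T"
    and U: "openin (top_of_set {0..1}) U" "U \<noteq> {}" "connected U"
    and e: "0 < \<epsilon>" "\<epsilon> < 1/2"
  obtains n where "{\<epsilon>..1 - \<epsilon>} \<subseteq> (T ^^ n) ` U"
proof -
  have "openin (top_of_set {0..1}) ({0..1} \<inter> {..<\<epsilon>})"
    "openin (top_of_set {0..1}) ({0..1} \<inter> {1 - \<epsilon><..})"
    by (auto intro: openin_open_Int)
  moreover have "0 \<in> {0..1} \<inter> {..<\<epsilon>}" "1 \<in> {0..1} \<inter> {1 - \<epsilon><..}"
    using e by auto
  \<comment> \<open>Mixing gives all sufficiently late times, so at time \<open>max n1 n2\<close>
    the image of \<open>U\<close> reaches both ends at once.\<close>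
  ultimately obtain n1 n2
    where "\<forall>m\<ge>n1. (T ^^ m) ` U \<inter> ({0..1} \<inter> {..<\<epsilon>}) \<noteq> {}"
      and "\<forall>m\<ge>n2. (T ^^ m) ` U \<inter> ({0..1} \<inter> {1 - \<epsilon><..}) \<noteq> {}"
    using mix U(1,2) unfolding topologically_mixing_def by (metis empty_iff)
  then have "(T ^^ max n1 n2) ` U \<inter> ({0..1} \<inter> {..<\<epsilon>}) \<noteq> {}"
    "(T ^^ max n1 n2) ` U \<inter> ({0..1} \<inter> {1 - \<epsilon><..}) \<noteq> {}" by auto
  then obtain x y where xy: "x \<in> (T ^^ max n1 n2) ` U" "x < \<epsilon>" "y \<in> (T ^^ max n1 n2) ` U" "1 - \<epsilon> < y"
    by blast
  have "continuous_on U (T ^^ max n1 n2)"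
    using continuous_interval_map_funpow[OF T] openin_imp_subset[OF U(1)] continuous_on_subset
    unfolding continuous_interval_map_def by blast
  then have "connected ((T ^^ max n1 n2) ` U)"
    using U(3) by (rule connected_continuous_image)
  then have "{x..y} \<subseteq> (T ^^ max n1 n2) ` U"
    using xy by (intro connected_contains_Icc)
  moreover have "{\<epsilon>..1 - \<epsilon>} \<subseteq> {x..y}" using xy by auto
  ultimately show thesis using that by blast
qed

theorem proposition10:
  fixes T :: "real \<Rightarrow> real" and P :: "real set set"
  assumes "T \<in> CPMM"
    and "markov_partition T P"
  shows "(leo T \<longrightarrow>
      (\<forall>l>0. \<forall>v. lambda_solution P (transition_matrix T) l v \<longrightarrow> (\<lambda>i. \<bar>v i\<bar>) summable_on P)) \<and>
    (\<forall>l>0. \<forall>v. lambda_solution P (transition_matrix T) l v \<longrightarrow>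
      (\<forall>\<epsilon>\<in>{0<..<1/2}. v summable_on {j \<in> P. j \<subseteq> {\<epsilon><..<1 - \<epsilon>}}))"
proof -
  note P = assms(2)
  have T: "continuous_interval_map T" and mix: "topologically_mixing T"
    using assms(1) by (auto simp: CPMM_def)
  have open_interior: "openin (top_of_set {0..1}) (interior i) \<and> interior i \<noteq> {} \<and> connected (interior i)"
    if i: "i \<in> P" for i
  proof -
    obtain a b where "0 \<le> a" "a < b" "b \<le> 1" "i = {a..b}"
      using markov_partition_interval[OF P i] .
    then show ?thesis by (auto simp: openin_open_eq intro!: open_subset)
  qed
  \<comment> \<open>Shared by both claims: \<open>B\<close> will be the whole unit interval under
    leo, and the open core of the unit interval under mixing. A solution is nonzero, so
    \<open>P\<close> has an element at which to start.\<close>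
  have sub: "v summable_on {j \<in> P. j \<subseteq> B}"
    if l: "l > 0" and v: "lambda_solution P (transition_matrix T) l v"
      and B: "\<And>i. i \<in> P \<Longrightarrow> \<exists>n. B \<subseteq> (T ^^ n) ` interior i" for l v B
  proof -
    obtain i where i: "i \<in> P" using v unfolding lambda_solution_def by blast
    obtain n where "B \<subseteq> (T ^^ n) ` interior i" using B[OF i] by blast
    then have "B \<subseteq> (T ^^ n) ` i" using interior_subset by blast
    then have "{j \<in> P. j \<subseteq> B} \<subseteq> {j \<in> P. j \<subseteq> (T ^^ n) ` i}" by blast
    with lambda_solution_summable_on_iterate[OF T P v l i, of n] show ?thesis
      by (rule summable_on_subset_banach)
  qed
  have "(\<lambda>i. \<bar>v i\<bar>) summable_on P"
    if "leo T" and l: "l > 0" and v: "lambda_solution P (transition_matrix T) l v" for l v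
  proof -
    have "v summable_on {j \<in> P. j \<subseteq> {0..1}}"
    proof (rule sub[OF l v])
      fix i assume "i \<in> P"
      then show "\<exists>n. {0..1} \<subseteq> (T ^^ n) ` interior i"
        using \<open>leo T\<close>[unfolded leo_def, rule_format, of "interior i"] open_interior[of i] by auto
    qed
    moreover have "j \<subseteq> {0..1}" if "j \<in> P" for j
      using markov_partition_interval[OF P that] by (metis atLeastatMost_subset_iff)
    then have "{j \<in> P. j \<subseteq> {0..1}} = P" by blast
    \<comment> \<open>Nonnegativity turns summability of \<open>v\<close> into the absolute
      summability that defines membership in the space of summable sequences.\<close>
    moreover have "\<bar>v i\<bar> = v i" if "i \<in> P" for i
      using lambda_solution_nonneg[OF v that] by simp
    ultimately show ?thesis using summable_on_cong[of P "\<lambda>i. \<bar>v i\<bar>" v] by simp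
  qed
  moreover have "v summable_on {j \<in> P. j \<subseteq> {\<epsilon><..<1 - \<epsilon>}}"
    if l: "l > 0" and v: "lambda_solution P (transition_matrix T) l v" and e: "\<epsilon> \<in> {0<..<1/2}"
    for l v \<epsilon>
  proof (rule sub[OF l v])
    fix i assume "i \<in> P"
    then obtain n where "{\<epsilon>..1 - \<epsilon>} \<subseteq> (T ^^ n) ` interior i"
      using topologically_mixing_covers_core[OF T mix, of "interior i" \<epsilon>] open_interior[of i] e
      by auto
    moreover have "{\<epsilon><..<1 - \<epsilon>} \<subseteq> {\<epsilon>..1 - \<epsilon>}" by auto
    ultimately show "\<exists>n. {\<epsilon><..<1 - \<epsilon>} \<subseteq> (T ^^ n) ` interior i" by blast
  qed
  ultimately show ?thesis by blast
qed

end
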